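(* Let $G=(V,E)$ be a finite connected undirected simple graph and let $v\in V$ with ego-network $G_{N(v)}$. For $u\in N(v)$ put $\widehat{\varphi}_{G_{N(v)}}(u)=\min\{\varphi_G(v),\varphi_G(u)-1\}$, and define $$\widehat{h}(v)=\max_{x\in\mathbb{Z}_{+}}\bigl\{x : |\{u\in N(v): \widehat{\varphi}_{G_{N(v)}}(u)\geq x\}|\geq x\cdot(x+1)\bigr\},$$ where the maximum is taken to be $0$ if no positive integer $x$ satisfies the condition. Then $\widehat{h}(v)$ is an upper bound on the $h$-index based structural diversity score of $v$: $$h(v)\leq \widehat{h}(v).$$
   Context: Let $n=|V|$. For $v\in V$, $N(v)$ is the set of neighbours of $v$, and the ego-network of $v$ is $G_{N(v)}$, the subgraph of $G$ induced by $N(v)$ (it does not contain $v$). Subgraphs are non-empty. For a subgraph $H$, its coreness is its minimum degree, $\varphi(H)=\min_{x\in V(H)} d_H(x)$. For a graph $F$ and $x\in V(F)$, the coreness of $x$ in $F$ is $\varphi_F(x)=\max\{\varphi(H): H\subseteq F,\ x\in V(H)\}$. Discriminative core: a subgraph $H$ of a graph $F$ is a discriminative core of $F$ if, with $t=\varphi(H)$, $H$ is a maximal connected $t$-core of $F$ (i.e. $H$ is connected, every vertex of $H$ has degree at least $t$ in $H$, and $H$ is inclusion-maximal among subgraphs of $F$ with these two properties), and there is no subgraph $H'\subseteq H$ with $\varphi(H')>\varphi(H)$. Diversity score: for $1\le r\le n$ let $c_v(r)$ be the number of discriminative cores $H$ of $G_{N(v)}$ with $\varphi(H)=r$. The $h$-index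 based structural diversity score of $v$ is $h(v)=\max\{r : \sum_{i=r}^{n}c_v(i)\geq r\}$, the maximum being over $1\le r\le n$ and taken to be $0$ if no such $r$ exists. *)

theory Defs
  imports "Graph_Theory.Digraph_Component"
begin

text \<open>
  As in Graph_Theory, a finite undirected simple graph is a finite loop-free symmetric
  digraph without parallel arcs (locale \<^term>\<open>graph\<close>): an undirected edge is a pair of
  opposite arcs, so the degree of a vertex is its \<^term>\<open>out_degree\<close>. A digraph-theoretic
  subgraph of such an object may be asymmetric, which is why undirected subgraphs are
  required to satisfy \<^term>\<open>graph\<close> themselves.
\<close>

definition simple_subgraph :: "('a, 'b) pre_digraph \<Rightarrow> ('a, 'b) pre_digraph \<Rightarrow> bool" where
  "simple_subgraph H F \<longleftrightarrow> subgraph H F \<and> graph H \<and> verts H \<noteq> {}"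

definition neighbours :: "('a, 'b) pre_digraph \<Rightarrow> 'a \<Rightarrow> 'a set" where
  "neighbours G v = {u. v \<rightarrow>\<^bsub>G\<^esub> u}"

definition ego_network :: "('a, 'b) pre_digraph \<Rightarrow> 'a \<Rightarrow> ('a, 'b) pre_digraph" where
  "ego_network G v = G \<restriction> neighbours G v"

definition coreness :: "('a, 'b) pre_digraph \<Rightarrow> nat" where
  "coreness H = Min (out_degree H ` verts H)"

definition vertex_coreness :: "('a, 'b) pre_digraph \<Rightarrow> 'a \<Rightarrow> nat" where
  "vertex_coreness F x = Max {coreness H | H. simple_subgraph H F \<and> x \<in> verts H}"

definition connected_core :: "nat \<Rightarrow> ('a, 'b) pre_digraph \<Rightarrow> bool" where
  "connected_core t H \<longleftrightarrow> graph H \<and> connected H \<and> (\<forall>x \<in> verts H. t \<le> out_degree H x)"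

text \<open>
  \<^term>\<open>connected\<close> includes non-emptiness, so all graphs compared by
  \<^term>\<open>pre_digraph.max_subgraph\<close> below are non-empty undirected subgraphs of \<open>F\<close>.
\<close>

definition discriminative_core :: "('a, 'b) pre_digraph \<Rightarrow> ('a, 'b) pre_digraph \<Rightarrow> bool" where
  "discriminative_core F H \<longleftrightarrow>
     pre_digraph.max_subgraph F (connected_core (coreness H)) H \<and>
     \<not> (\<exists>H'. simple_subgraph H' H \<and> coreness H' > coreness H)"

definition core_count :: "('a, 'b) pre_digraph \<Rightarrow> 'a \<Rightarrow> nat \<Rightarrow> nat" where
  "core_count G v r = card {H. discriminative_core (ego_network G v) H \<and> coreness H = r}"

definition max_or_zero :: "nat set \<Rightarrow> nat" where
  "max_or_zero S = (if S = {} then 0 else Max S)"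

definition h_index_score :: "('a, 'b) pre_digraph \<Rightarrow> 'a \<Rightarrow> nat" where
  "h_index_score G v =
     max_or_zero {r \<in> {1..card (verts G)}. (\<Sum>i = r..card (verts G). core_count G v i) \<ge> r}"

text \<open>Integer-valued, so that the subtraction is not truncated.\<close>

definition ego_coreness_bound :: "('a, 'b) pre_digraph \<Rightarrow> 'a \<Rightarrow> 'a \<Rightarrow> int" where
  "ego_coreness_bound G v u =
     min (int (vertex_coreness G v)) (int (vertex_coreness G u) - 1)"

definition h_index_bound :: "('a, 'b) pre_digraph \<Rightarrow> 'a \<Rightarrow> nat" where
  "h_index_bound G v =
     max_or_zero {x. x \<ge> 1 \<and>
       card {u \<in> neighbours G v. ego_coreness_bound G v u \<ge> int x} \<ge> x * (x + 1)}"

end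

theory Submission
  imports Defs
begin

text \<open>
  Distinct discriminative cores of a graph have disjoint vertex sets: the union of two
  intersecting ones is again connected and keeps the smaller of the two minimum degrees, so the
  core with the smaller coreness contains the other one, which is excluded unless they coincide.
  A core of coreness at least \<open>r\<close> has more than \<open>r\<close> vertices. Hence if the ego-network of \<open>v\<close> has
  \<open>r\<close> such cores, they cover at least \<open>r (r + 1)\<close> neighbours of \<open>v\<close>. Adding \<open>v\<close> itself to one of
  these cores raises every degree by one, so that \<open>v\<close> and all the covered neighbours have coreness
  at least \<open>r + 1\<close> in the whole graph.
\<close>

section \<open>Degrees and coreness of undirected graphs\<close>

lemma (in graph) graph_induce_subgraph:
  assumes "S \<subseteq> verts G"
  shows "graph (G \<restriction> S)"
proof -
  have ind: "induced_subgraph (G \<restriction> S) G"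
    using assms by blast
  interpret S: digraph "G \<restriction> S"
    by (rule digraphI_induced[OF ind])
  show ?thesis
    using induced_graph_imp_symmetric[OF sym_arcs ind] by blast
qed

lemma (in fin_digraph) subgraph_out_degree:
  assumes "subgraph H G"
  shows "out_degree H x \<le> out_degree G x"
proof -
  have "out_arcs H x \<subseteq> out_arcs G x"
    using assms by (auto simp: subgraph_def compatible_def)
  then show ?thesis
    unfolding out_degree_def by (intro card_mono finite_out_arcs)
qed

text \<open>Without parallel arcs, \<open>head\<close> is injective on the out-arcs of a vertex.
  Degrees can then be compared by inclusions of vertex sets.\<close>

lemma (in digraph) out_degree_eq_card_neighbours:
  "out_degree G x = card (neighbours G x)"
proof -
  have "head G ` out_arcs G x = neighbours G x"
    by (force simp: neighbours_def arcs_ends_conv)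
  moreover have "inj_on (head G) (out_arcs G x)"
    by (rule inj_onI) (auto intro: no_multi_arcs simp: arc_to_ends_def)
  ultimately show ?thesis
    unfolding out_degree_def by (metis card_image)
qed

text \<open>Since there are no loops, a vertex is missing from its own neighbourhood. This
  strictness is the source of the factor \<open>r + 1\<close> in the final count.\<close>

lemma (in digraph) out_degree_less_card_verts:
  assumes "x \<in> verts G"
  shows "out_degree G x < card (verts G)"
proof -
  have "neighbours G x \<subset> verts G"
    using assms adj_in_verts adj_not_same unfolding neighbours_def by blast
  then show ?thesis
    unfolding out_degree_eq_card_neighbours by (simp add: psubset_card_mono)
qed

lemma subgraph_antisym:
  assumes "subgraph H H'" "subgraph H' H"
  shows "H = H'"
  using assms by (auto simp: subgraph_def compatible_def)

lemma (in fin_digraph) coreness_le_out_degree: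
  assumes "x \<in> verts G"
  shows "coreness G \<le> out_degree G x"
  using assms unfolding coreness_def by simp

lemma (in fin_digraph) coreness_geI:
  assumes "verts G \<noteq> {}" "\<And>x. x \<in> verts G \<Longrightarrow> t \<le> out_degree G x"
  shows "t \<le> coreness G"
  using assms unfolding coreness_def by simp

lemma (in fin_digraph) coreness_le_vertex_coreness:
  assumes "simple_subgraph H G" "x \<in> verts H"
  shows "coreness H \<le> vertex_coreness G x"
proof -
  \<comment> \<open>The degree of \<open>x\<close> in the whole graph bounds all the values under
    \<open>Max\<close>, so their set is finite and \<open>Max\<close> is meaningful.\<close>
  have "coreness K \<le> out_degree G x" if "simple_subgraph K G" "x \<in> verts K" for K
  proof -
    interpret K: graph K
      using that by (simp add: simple_subgraph_def)
    show ?thesis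
      using K.coreness_le_out_degree[OF that(2)] subgraph_out_degree[of K x] that(1)
      unfolding simple_subgraph_def by linarith
  qed
  then have "{coreness K | K. simple_subgraph K G \<and> x \<in> verts K} \<subseteq> {..out_degree G x}"
    by auto
  then have "finite {coreness K | K. simple_subgraph K G \<and> x \<in> verts K}"
    by (rule finite_subset) simp
  then show ?thesis
    using assms unfolding vertex_coreness_def by (auto intro: Max_ge)
qed

section \<open>Unions of connected cores\<close>

lemma graph_union:
  assumes "digraph F" "subgraph H F" "subgraph K F" "symmetric H" "symmetric K"
  shows "graph (union H K)"
proof -
  interpret F: digraph F by fact
  have comp: "compatible H F" "compatible K F" "compatible H K"
    using assms(2,3) by (auto simp: subgraph_def compatible_def)
  \<comment> \<open>The common supergraph \<open>F\<close> rules out parallel arcs: two unrelated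
    graphs could join the same vertices by different arcs.\<close>
  interpret U: digraph "union H K"
    using F.digraph_subgraph[OF subgraph_union[OF assms(2) comp(1) assms(3) comp(2)]] .
  have "arcs_ends (union H K) = arcs_ends H \<union> arcs_ends K"
    using comp(3) by (auto simp: arcs_ends_conv compatible_def)
  then have "symmetric (union H K)"
    using assms(4,5) by (simp add: symmetric_def sym_Un)
  then show ?thesis by blast
qed

lemma (in wf_digraph) strongly_connected_imp_connected:
  assumes "strongly_connected G"
  shows "connected G"
  using assms reachable_mk_symmetricI by (intro connectedI) (auto simp: strongly_connected_def)

lemma connected_core_union:
  assumes "digraph F" "subgraph H F" "subgraph K F"
    and "connected_core t H" "connected_core t K"
    and "verts H \<inter> verts K \<noteq> {}"
  shows "connected_core t (union H K)"
proof -
  interpret H: graph H using assms(4) by (simp add: connected_core_def)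
  interpret K: graph K using assms(5) by (simp add: connected_core_def)
  interpret U: graph "union H K"
    using assms(1-3) H.sym_arcs K.sym_arcs by (rule graph_union)
  have comp: "compatible H K"
    using assms(2,3) by (auto simp: subgraph_def compatible_def)
  note subs = subgraphs_of_union[OF H.wf_digraph K.wf_digraph comp]
  \<comment> \<open>The gluing fact for a common vertex concerns strong connectedness; symmetry
    gives it for \<open>H\<close> and \<open>K\<close>, and the union is then connected in the
    undirected sense.\<close>
  have "strongly_connected H" "strongly_connected K"
    using assms(4,5) H.symmetric_connected_imp_strongly_connected[OF H.sym_arcs]
      K.symmetric_connected_imp_strongly_connected[OF K.sym_arcs]
    by (auto simp: connected_core_def)
  then have "connected (union H K)"
    using strongly_connected_non_disj[OF H.wf_digraph K.wf_digraph comp _ _ assms(6)]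
    by (intro U.strongly_connected_imp_connected) blast
  moreover have "t \<le> out_degree (union H K) x" if "x \<in> verts (union H K)" for x
    using that assms(4,5) U.subgraph_out_degree[OF subs(1), of x]
      U.subgraph_out_degree[OF subs(2), of x]
    by (auto simp: connected_core_def intro: order_trans)
  ultimately show ?thesis
    using U.graph_axioms by (simp add: connected_core_def)
qed

lemma connected_core_mono:
  assumes "connected_core t H" "s \<le> t"
  shows "connected_core s H"
  using assms by (auto simp: connected_core_def intro: order_trans)

section \<open>Disjointness of discriminative cores\<close>

lemma discriminative_coreD:
  assumes "discriminative_core F H"
  shows "subgraph H F" "connected_core (coreness H) H" "graph H" "verts H \<noteq> {}"
  using assms
  by (auto simp: discriminative_core_def pre_digraph.max_subgraph_def connected_core_def
      connected_def strongly_connected_def)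

text \<open>With its threshold lowered to \<open>coreness H\<close>, \<open>K\<close> can be joined
  to \<open>H\<close>. The union then competes with \<open>H\<close> for maximality and so equals
  it.\<close>

lemma discriminative_core_absorbs:
  assumes "digraph F" "discriminative_core F H" "discriminative_core F K"
    and "coreness H \<le> coreness K" "verts H \<inter> verts K \<noteq> {}"
  shows "subgraph K H"
proof -
  note H = discriminative_coreD[OF assms(2)] and K = discriminative_coreD[OF assms(3)]
  have comp: "compatible H K" "compatible H F" "compatible K F"
    using H(1) K(1) by (auto simp: subgraph_def compatible_def)
  have wf: "wf_digraph H" "wf_digraph K"
    using H(1) K(1) by (auto simp: subgraph_def)
  note subs = subgraphs_of_union[OF wf comp(1)]
  have "connected_core (coreness H) (union H K)"
    using assms(1) H(1) K(1) H(2) connected_core_mono[OF K(2) assms(4)] assms(5)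
    by (rule connected_core_union)
  moreover have "subgraph (union H K) F"
    using H(1) comp(2) K(1) comp(3) by (rule subgraph_union)
  ultimately have "union H K = H"
    using assms(2) subs(1)
    unfolding discriminative_core_def pre_digraph.max_subgraph_def by blast
  then show ?thesis
    using subs(2) by simp
qed

lemma discriminative_cores_disjoint:
  assumes "digraph F" "discriminative_core F H" "discriminative_core F K" "H \<noteq> K"
  shows "verts H \<inter> verts K = {}"
proof (rule ccontr)
  \<comment> \<open>Stated for arbitrary \<open>H'\<close> and \<open>K'\<close>, so that it serves
    whichever of the two corenesses is smaller.\<close>
  have eq: "H' = K'"
    if H: "discriminative_core F H'" and K: "discriminative_core F K'"
      and le: "coreness H' \<le> coreness K'" and meet: "verts H' \<inter> verts K' \<noteq> {}" for H' K'
  proof -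
    have sub: "subgraph K' H'"
      using assms(1) H K le meet by (rule discriminative_core_absorbs)
    then have "simple_subgraph K' H'"
      using discriminative_coreD(3,4)[OF K] by (simp add: simple_subgraph_def)
    \<comment> \<open>A discriminative core has no subgraph of larger coreness. The two corenesses
      therefore agree, and absorption works in the other direction too.\<close>
    then have "coreness K' \<le> coreness H'"
      using H by (auto simp: discriminative_core_def not_less)
    then have "subgraph H' K'"
      using meet by (intro discriminative_core_absorbs[OF assms(1) K H]) auto
    then show ?thesis
      using sub by (rule subgraph_antisym)
  qed
  assume "verts H \<inter> verts K \<noteq> {}"
  then have "verts K \<inter> verts H \<noteq> {}" by blast
  then show False
    using eq[OF assms(2,3)] eq[OF assms(3,2)] \<open>verts H \<inter> verts K \<noteq> {}\<close> assms(4)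
    by (metis nle_le)
qed

section \<open>From the ego-network back to the whole graph\<close>

lemma (in graph) neighbours_subset_verts: "neighbours G v \<subseteq> verts G"
  using adj_in_verts by (auto simp: neighbours_def)

lemma (in graph) graph_ego_network: "graph (ego_network G v)"
  unfolding ego_network_def by (rule graph_induce_subgraph[OF neighbours_subset_verts])

text \<open>Every vertex of \<open>H\<close> gains the neighbour \<open>v\<close>, while
  \<open>v\<close> is adjacent to all of \<open>H\<close>, which has more than \<open>r\<close>
  vertices. The induced subgraph keeps all arcs of \<open>H\<close> and all arcs between
  \<open>v\<close> and \<open>H\<close>.\<close>

lemma (in graph) coreness_add_apex:
  assumes "subgraph H G" "graph H" "verts H \<noteq> {}" "verts H \<subseteq> neighbours G v"
    and "\<And>x. x \<in> verts H \<Longrightarrow> r \<le> out_degree H x"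
  shows "simple_subgraph (G \<restriction> insert v (verts H)) G"
    and "r + 1 \<le> coreness (G \<restriction> insert v (verts H))"
proof -
  let ?K = "G \<restriction> insert v (verts H)"
  interpret H: graph H by fact
  \<comment> \<open>\<open>v\<close> is a vertex of \<open>G\<close> because the non-empty
    \<open>H\<close> contains a neighbour of it.\<close>
  have sub: "insert v (verts H) \<subseteq> verts G"
    using assms(1,3,4) adj_in_verts by (auto simp: neighbours_def subgraph_def)
  interpret K: graph ?K
    using sub by (rule graph_induce_subgraph)
  show "simple_subgraph ?K G"
    using sub subgraph_induce_subgraphI K.graph_axioms by (simp add: simple_subgraph_def)
  have v: "v \<notin> verts H"
    using assms(4) adj_not_same by (auto simp: neighbours_def)
  have arcs_K: "x \<rightarrow>\<^bsub>?K\<^esub> y \<longleftrightarrow> x \<rightarrow>\<^bsub>G\<^esub> y \<and> x \<in> insert v (verts H) \<and> y \<in> insert v (verts H)" for x y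
    by (auto simp: arcs_ends_conv)
  have fin: "finite (neighbours ?K x)" for x
    using K.neighbours_subset_verts K.finite_verts by (rule finite_subset)
  show "r + 1 \<le> coreness ?K"
  proof (rule K.coreness_geI)
    fix x assume "x \<in> verts ?K"
    then consider "x = v" | "x \<in> verts H" by auto
    then show "r + 1 \<le> out_degree ?K x"
    proof cases
      case 1
      obtain y where "y \<in> verts H" using assms(3) by blast
      then have "r + 1 \<le> card (verts H)"
        using assms(5) H.out_degree_less_card_verts by fastforce
      also have "\<dots> \<le> card (neighbours ?K v)"
        using assms(4) by (intro card_mono fin) (auto simp: neighbours_def arcs_K)
      finally show ?thesis
        using 1 K.out_degree_eq_card_neighbours by simp
    next
      case 2
      have "v \<notin> neighbours H x"
        using v H.adj_in_verts by (auto simp: neighbours_def)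
      moreover have "finite (neighbours H x)"
        using H.neighbours_subset_verts H.finite_verts by (rule finite_subset)
      moreover have "r \<le> card (neighbours H x)"
        using assms(5)[OF 2] by (simp add: H.out_degree_eq_card_neighbours)
      ultimately have "r + 1 \<le> card (insert v (neighbours H x))"
        by simp
      also have "\<dots> \<le> card (neighbours ?K x)"
      proof (intro card_mono fin subsetI)
        fix y assume "y \<in> insert v (neighbours H x)"
        then show "y \<in> neighbours ?K x"
          using 2 assms(4) graph_symmetric adj_mono[OF _ assms(1)] H.adj_in_verts
          by (auto simp: neighbours_def arcs_K)
      qed
      finally show ?thesis
        using K.out_degree_eq_card_neighbours by simp
    qed
  qed simp
qed

text \<open>One witness serves both terms of the minimum: \<open>?K\<close> contains
  \<open>v\<close> and \<open>u\<close> and has coreness at least \<open>r + 1\<close>, which pays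
  for the subtracted 1 in the term of \<open>u\<close>.\<close>

lemma (in graph) ego_coreness_bound_ge:
  assumes "discriminative_core (ego_network G v) H" "u \<in> verts H" "r \<le> coreness H"
  shows "u \<in> neighbours G v" "int r \<le> ego_coreness_bound G v u"
proof -
  note H = discriminative_coreD[OF assms(1)]
  have nb: "verts H \<subseteq> neighbours G v"
    using H(1) by (auto simp: subgraph_def ego_network_def)
  then show "u \<in> neighbours G v"
    using assms(2) by blast
  have "subgraph (ego_network G v) G"
    unfolding ego_network_def by (rule subgraph_induce_subgraphI[OF neighbours_subset_verts])
  then have sub: "subgraph H G"
    using H(1) subgraph_trans by blast
  interpret H: graph H by (rule H(3))
  have deg: "r \<le> out_degree H x" if "x \<in> verts H" for x
    using H.coreness_le_out_degree[OF that] assms(3) by linarith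
  let ?K = "G \<restriction> insert v (verts H)"
  have K: "simple_subgraph ?K G" "r + 1 \<le> coreness ?K"
    using coreness_add_apex[OF sub H(3,4) nb deg] by auto
  then have "r + 1 \<le> vertex_coreness G x" if "x \<in> insert v (verts H)" for x
    using coreness_le_vertex_coreness[OF K(1), of x] that by simp
  from this[of v] this[of u] show "int r \<le> ego_coreness_bound G v u"
    using assms(2) by (simp add: ego_coreness_bound_def)
qed

section \<open>Counting the covered neighbours\<close>

lemma finite_discriminative_cores:
  assumes "digraph F"
  shows "finite {H. discriminative_core F H}"
proof -
  interpret F: digraph F by fact
  have "verts ` {H. discriminative_core F H} \<subseteq> Pow (verts F)"
    using discriminative_coreD(1) by (fastforce simp: subgraph_def)
  then have "finite (verts ` {H. discriminative_core F H})"
    by (rule finite_subset) simp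
  \<comment> \<open>Distinct cores have disjoint non-empty vertex sets, so a core is determined by
    its vertex set.\<close>
  moreover have "inj_on verts {H. discriminative_core F H}"
    using discriminative_cores_disjoint[OF assms] discriminative_coreD(4)
    by (intro inj_onI) fastforce
  ultimately show ?thesis
    by (rule finite_imageD)
qed

text \<open>Cores of different coreness form disjoint classes, so the sum counts their union. As
  \<open>n\<close> is arbitrary, cores of coreness above \<open>n\<close> may be missed, hence only
  an inequality.\<close>

lemma (in graph) sum_core_count_le:
  "(\<Sum>i = r..n. core_count G v i)
    \<le> card {H. discriminative_core (ego_network G v) H \<and> r \<le> coreness H}"
proof -
  interpret F: graph "ego_network G v" by (rule graph_ego_network)
  let ?D = "\<lambda>P. {H. discriminative_core (ego_network G v) H \<and> P (coreness H)}"
  have fin: "finite (?D P)" for P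
    using finite_discriminative_cores[OF F.digraph_axioms] by (rule rev_finite_subset) auto
  have "(\<Sum>i = r..n. core_count G v i) = card (\<Union>i\<in>{r..n}. ?D (\<lambda>k. k = i))"
    unfolding core_count_def by (subst card_UN_disjoint) (auto intro: fin)
  also have "\<dots> \<le> card (?D (\<lambda>k. r \<le> k))"
    by (intro card_mono fin) auto
  finally show ?thesis .
qed

lemma (in graph) card_ego_coreness_bound_ge:
  assumes "r \<le> card {H. discriminative_core (ego_network G v) H \<and> r \<le> coreness H}"
  shows "r * (r + 1) \<le> card {u \<in> neighbours G v. int r \<le> ego_coreness_bound G v u}"
proof -
  interpret F: graph "ego_network G v" by (rule graph_ego_network)
  let ?D = "{H. discriminative_core (ego_network G v) H \<and> r \<le> coreness H}"
  have fin: "finite ?D"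
    using finite_discriminative_cores[OF F.digraph_axioms] by (rule rev_finite_subset) auto
  have big: "r + 1 \<le> card (verts H)" if H: "H \<in> ?D" for H
  proof -
    interpret H: graph H using H discriminative_coreD(3) by blast
    obtain x where "x \<in> verts H" using H discriminative_coreD(4) by blast
    then show ?thesis
      using H H.coreness_le_out_degree H.out_degree_less_card_verts by fastforce
  qed
  have "r * (r + 1) \<le> card ?D * (r + 1)"
    using assms by (rule mult_right_mono) simp
  also have "\<dots> \<le> (\<Sum>H\<in>?D. card (verts H))"
    using sum_bounded_below[of ?D "r + 1" "\<lambda>H. card (verts H)"] big by simp
  also have "\<dots> = card (\<Union>H\<in>?D. verts H)"
  proof (rule card_UN_disjoint[symmetric])
    \<comment> \<open>An infinite set has \<open>card\<close> 0, so the lower bound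
      \<open>r + 1\<close> already forces finiteness.\<close>
    show "\<forall>H\<in>?D. finite (verts H)"
      using big card.infinite by fastforce
    show "\<forall>H\<in>?D. \<forall>K\<in>?D. H \<noteq> K \<longrightarrow> verts H \<inter> verts K = {}"
      using discriminative_cores_disjoint[OF F.digraph_axioms] by blast
  qed (rule fin)
  also have "\<dots> \<le> card {u \<in> neighbours G v. int r \<le> ego_coreness_bound G v u}"
  proof (rule card_mono)
    show "finite {u \<in> neighbours G v. int r \<le> ego_coreness_bound G v u}"
      using finite_subset[OF neighbours_subset_verts finite_verts] by simp
    show "(\<Union>H\<in>?D. verts H) \<subseteq> {u \<in> neighbours G v. int r \<le> ego_coreness_bound G v u}"
      using ego_coreness_bound_ge by blast
  qed
  finally show ?thesis .
qed

lemma max_or_zero_mono: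
  assumes "S \<subseteq> T" "finite T"
  shows "max_or_zero S \<le> max_or_zero T"
  using assms by (auto simp: max_or_zero_def intro: Max_mono)

theorem lemma5p5:
  fixes G :: "('a, 'b) pre_digraph" and v :: 'a
  assumes "graph G"
    and "connected G"
    and "v \<in> verts G"
  shows "h_index_score G v \<le> h_index_bound G v"
proof -
  interpret graph G by fact
  let ?U = "\<lambda>x. {u \<in> neighbours G v. ego_coreness_bound G v u \<ge> int x}"
  let ?T = "{x. x \<ge> 1 \<and> card (?U x) \<ge> x * (x + 1)}"
  \<comment> \<open>This bounds \<open>?T\<close>, so that the \<open>Max\<close> in
    \<open>h_index_bound\<close> is a true maximum.\<close>
  have "x \<le> card (neighbours G v)" if "x \<in> ?T" for x
  proof -
    have "x \<le> x * (x + 1)" by simp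
    also have "\<dots> \<le> card (?U x)" using that by simp
    also have "\<dots> \<le> card (neighbours G v)"
      using finite_subset[OF neighbours_subset_verts finite_verts] by (intro card_mono) auto
    finally show ?thesis .
  qed
  then have "?T \<subseteq> {..card (neighbours G v)}" by blast
  then have "finite ?T"
    by (rule finite_subset) simp
  \<comment> \<open>Every \<open>r\<close> admissible for the score is admissible for the bound, so
    the maxima compare by inclusion.\<close>
  moreover have "{r \<in> {1..card (verts G)}.
      (\<Sum>i = r..card (verts G). core_count G v i) \<ge> r} \<subseteq> ?T"
    using card_ego_coreness_bound_ge order_trans[OF _ sum_core_count_le] by auto
  ultimately show ?thesis
    unfolding h_index_score_def h_index_bound_def by (intro max_or_zero_mono)
qed

end
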